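(* Consider the $GI/M/1/n$ queueing system with fixed interarrival distribution function $A$ and fixed service rate $\mu$ (the same for all $n$), and let $p_n$ be its loss probability. Assume that $\rho=1$ and $\rho_2<\infty$. Then as $n\to\infty$ $$\frac{1}{p_{n+1}}-\frac{1}{p_n}=\frac{2}{\rho_2}+o(1).$$
   Context: $GI/M/1/n$ queue: a single-server loss system in which interarrival times are i.i.d. nonnegative random variables with distribution function $A(x)$ having mean $1/\lambda$, $0<\lambda<\infty$; service times are i.i.d. exponential with parameter $\mu>0$, independent of arrivals; the system holds at most $n$ customers (the buffer size $n$ includes the position at the server), and customers arriving when the system is full are lost. Notation: $\alpha(s)=\int_0^\infty e^{-sx}\,dA(x)$; $\rho=\lambda/\mu$; $\rho_m=\mu^m\int_0^\infty x^m\,dA(x)$ for $m=1,2,\dots$ (so $\rho_1=\rho^{-1}$). The loss probability $p_n$ is the stationary probability that an arriving customer finds the system full. It exists for every value of $\rho$ and is given by $$p_n=\frac{1}{\sum_{j=0}^n\pi_j},\qquad \sum_{j=0}^\infty\pi_jz^j=\frac{(1-z)\,\alpha(\mu-\mu z)}{\alpha(\mu-\mu z)-z},\quad |z|<\sigma,$$ where $\sigma$ is the minimum nonnegative solution of $z=\alpha(\mu-\mu z)$; $\sigma\in(0,1)$ if $\lambda<\mu$ and $\sigma=1$ otherwise. *)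

theory Defs
  imports "HOL-Probability.Probability" "HOL-Library.Landau_Symbols"
begin

text \<open>
  The GI/M/1/n loss system.  The interarrival law is a probability measure \<open>A\<close> on the reals
  (its distribution function is \<open>cdf A\<close>); services are exponential with rate \<open>\<mu>\<close>.  The system
  is observed just before arrival epochs.  By the memoryless property, immediately after an
  arrival instant the (remaining) service times of the customers present are i.i.d.
  exponential with rate \<open>\<mu>\<close> and independent of the time to the next arrival, so the number of
  customers found by successive arrivals is a Markov chain on \<open>{..n}\<close>.
\<close>

definition rho_moment :: "real measure \<Rightarrow> real \<Rightarrow> nat \<Rightarrow> real" where
  "rho_moment A \<mu> m = \<mu> ^ m * (\<integral>x. x ^ m \<partial>A)"

text \<open>Joint law of the time to the next arrival and of the successive (remaining) service times.\<close>

definition cycle_measure :: "real measure \<Rightarrow> real \<Rightarrow> (real \<times> (nat \<Rightarrow> real)) measure" where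
  "cycle_measure A \<mu> =
     A \<Otimes>\<^sub>M (\<Pi>\<^sub>M k\<in>(UNIV :: nat set). density lborel (exponential_density \<mu>))"

text \<open>An arrival finding \<open>i\<close> customers is lost if \<open>i = n\<close> and joins otherwise.\<close>

definition after_arrival :: "nat \<Rightarrow> nat \<Rightarrow> nat" where
  "after_arrival n i = (if i < n then Suc i else n)"

text \<open>
  With \<open>m\<close> customers present and no arrivals, the server is busy until the system empties,
  so the \<open>k\<close>-th departure takes place at time \<open>s 0 + \<dots> + s (k - 1)\<close>.
\<close>

definition departures :: "nat \<Rightarrow> real \<Rightarrow> (nat \<Rightarrow> real) \<Rightarrow> nat" where
  "departures m t s = card {k \<in> {1..m}. (\<Sum>i<k. s i) \<le> t}"

definition trans_prob :: "real measure \<Rightarrow> real \<Rightarrow> nat \<Rightarrow> nat \<Rightarrow> nat \<Rightarrow> real" where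
  "trans_prob A \<mu> n i j =
     measure (cycle_measure A \<mu>)
       {(t, s) \<in> space (cycle_measure A \<mu>).
          after_arrival n i - departures (after_arrival n i) t s = j}"

definition stationary :: "real measure \<Rightarrow> real \<Rightarrow> nat \<Rightarrow> nat pmf \<Rightarrow> bool" where
  "stationary A \<mu> n q \<longleftrightarrow>
     set_pmf q \<subseteq> {..n} \<and>
     (\<forall>j\<le>n. pmf q j = (\<Sum>i\<le>n. pmf q i * trans_prob A \<mu> n i j))"

text \<open>The stationary probability that an arriving customer finds the system full.\<close>

definition loss_prob :: "real measure \<Rightarrow> real \<Rightarrow> nat \<Rightarrow> real" where
  "loss_prob A \<mu> n = pmf (THE q. stationary A \<mu> n q) n"

end

theory Submission
  imports Defs "HOL-Complex_Analysis.Great_Picard"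
begin

text \<open>
  Let \<open>r k\<close> be the probability of \<open>k\<close> service completions in an interarrival time when the server
  never idles; it is a mixture of Poisson probabilities with mean \<open>1\<close> and second factorial moment
  \<open>\<rho>\<^sub>2\<close>.  Counted from the full state downwards, the stationary probabilities are proportional to a
  sequence \<open>level r\<close> that does not depend on \<open>n\<close>, so \<open>1 / p\<^sub>n\<close> is its partial sum up to \<open>n\<close> and
  the claim becomes \<open>level r n \<longlonglongrightarrow> 2 / \<rho>\<^sub>2\<close>.  Equating the flows across a cut turns the balance
  equations into a (perturbed) renewal equation whose kernel is the tail of \<open>r\<close>, a strictly positive
  probability weight with mean \<open>\<rho>\<^sub>2 / 2\<close>.  The limit then follows as in the discrete renewal theorem:
  along a subsequence realising the limsup, all shifts converge to the limsup as well, and the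
  conserved quantity of the renewal equation determines its value.
\<close>

section \<open>A renewal limit theorem\<close>

text \<open>Dominated convergence for series: \<open>a k * B\<close> majorises the terms uniformly
  in \<open>i\<close>, so Tannery's theorem applies.\<close>

lemma tendsto_suminf_mult:
  fixes a v :: "nat \<Rightarrow> real" and g :: "nat \<Rightarrow> nat \<Rightarrow> real"
  assumes "summable a" "\<And>k. 0 \<le> a k" "\<And>i k. \<bar>g i k\<bar> \<le> B"
    and "\<And>k. (\<lambda>i. g i k) \<longlonglongrightarrow> v k"
  shows "(\<lambda>i. \<Sum>k. a k * g i k) \<longlonglongrightarrow> (\<Sum>k. a k * v k)"
proof -
  have "\<forall>\<^sub>F (k, i) in at_top \<times>\<^sub>F sequentially. norm (a k * g i k) \<le> a k * B"
    using assms(2,3) by (intro always_eventually) (auto simp: abs_mult intro!: mult_left_mono)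
  moreover have "summable (\<lambda>k. a k * B)"
    by (intro summable_mult2 assms)
  moreover have "(\<lambda>i. a k * g i k) \<longlonglongrightarrow> a k * v k" for k
    by (intro tendsto_mult tendsto_const assms)
  ultimately show ?thesis
    using tannerys_theorem[of "\<lambda>k i. a k * g i k" "\<lambda>k. a k * v k" sequentially "\<lambda>k. a k * B"]
    by simp
qed

text \<open>The renewal equation alone only shows that the shifts of \<open>u\<close> flatten out
  near the limsup. The value comes from the conserved quantity \<open>inv\<close>: once every shift
  tends to \<open>L\<close>, it reads \<open>m * L = c\<close>. A one-sided bound suffices, because
  the hypotheses survive replacing \<open>u\<close> and \<open>c\<close> by their negatives.\<close>

lemma renewal_limsup_le:
  fixes f F u :: "nat \<Rightarrow> real"
  assumes f_pos: "\<And>k. 0 < f k" and f: "f sums 1"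
    and F_nonneg: "\<And>k. 0 \<le> F k" and F: "F sums m" "m \<noteq> 0"
    and u: "\<And>n. \<bar>u n\<bar> \<le> B"
    and ren: "(\<lambda>n. u n - (\<Sum>k<n. f k * u (n - Suc k))) \<longlonglongrightarrow> 0"
    and inv: "(\<lambda>n. \<Sum>k\<le>n. F k * u (n - k)) \<longlonglongrightarrow> c"
  shows "limsup (\<lambda>n. ereal (u n)) \<le> ereal (c / m)"
proof -
  define X where "X = limsup (\<lambda>n. ereal (u n))"
  obtain r where r: "strict_mono (r :: nat \<Rightarrow> nat)" "((\<lambda>n. ereal (u n)) \<circ> r) \<longlonglongrightarrow> X"
    using limsup_subseq_lim unfolding X_def by blast
  have B: "- B \<le> u n" "u n \<le> B" for n
    using u[of n] by auto
  have "ereal (- B) \<le> X"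
    by (rule LIMSEQ_le_const[OF r(2)]) (use B in auto)
  moreover have "X \<le> ereal B"
    by (rule LIMSEQ_le_const2[OF r(2)]) (use B in auto)
  ultimately obtain L where L: "X = ereal L"
    by (cases X) auto
  have "0 \<le> B"
    using u[of 0] by linarith
  \<comment> \<open>A diagonal subsequence along which every shift of \<open>u\<close> converges, the unshifted one to the
    limsup \<open>L\<close>.  Its limits \<open>v k \<le> L\<close> satisfy \<open>L = (\<Sum>k. f k * v (Suc k))\<close>, and as all \<open>f k\<close> are
    positive this forces \<open>v k = L\<close>.\<close>
  define g where "g i k = (if k \<le> r i then u (r i - k) else 0)" for i k
  have g_le: "\<bar>g i k\<bar> \<le> B" for i k
    using u \<open>0 \<le> B\<close> by (auto simp: g_def)
  obtain s where s: "strict_mono (s :: nat \<Rightarrow> nat)" "\<And>k. \<exists>l. (\<lambda>i. g (s i) k) \<longlonglongrightarrow> l"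
    using function_convergent_subsequence[of "UNIV :: nat set" g B] g_le by auto
  obtain v where v: "\<And>k. (\<lambda>i. g (s i) k) \<longlonglongrightarrow> v k"
    using s(2) by metis
  have rs: "filterlim (\<lambda>i. r (s i)) sequentially sequentially"
    using filterlim_compose[OF filterlim_subseq[OF r(1)] filterlim_subseq[OF s(1)]] .
  have v_le: "v k \<le> L" for k
  proof (rule field_le_epsilon)
    fix e :: real assume "0 < e"
    then have "X < ereal (L + e)"
      by (simp add: L)
    then have "\<forall>\<^sub>F n in sequentially. u n < L + e"
      unfolding X_def by (auto dest!: Limsup_lessD)
    moreover have "filterlim (\<lambda>i. r (s i) - k) sequentially sequentially"
      by (rule filterlim_compose[OF filterlim_minus_const_nat_at_top rs])
    ultimately have "\<forall>\<^sub>F i in sequentially. u (r (s i) - k) < L + e"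
      by (rule eventually_compose_filterlim)
    moreover have "\<forall>\<^sub>F i in sequentially. k \<le> r (s i)"
      using rs by (auto simp: filterlim_at_top)
    ultimately have "\<forall>\<^sub>F i in sequentially. g (s i) k \<le> L + e"
      by eventually_elim (auto simp: g_def)
    then show "v k \<le> L + e"
      by (intro tendsto_upperbound[OF v]) auto
  qed
  have "(\<lambda>i. u (r (s i))) \<longlonglongrightarrow> L"
    using LIMSEQ_subseq_LIMSEQ[OF r(2) s(1)] by (simp add: L o_def)
  moreover have "g i 0 = u (r i)" for i
    by (simp add: g_def)
  ultimately have v0: "v 0 = L"
    using LIMSEQ_unique[OF v[of 0]] by simp
  \<comment> \<open>Since \<open>g i k\<close> is 0 for \<open>k > r i\<close>, the finite
    convolutions are full series, and limits can be taken term by term.\<close>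
  have sum_f: "(\<Sum>k. f k * g i (Suc k)) = (\<Sum>k<r i. f k * u (r i - Suc k))" for i
    by (subst suminf_finite[of "{..<r i}"]) (auto simp: g_def intro!: sum.cong)
  have sum_F: "(\<Sum>k. F k * g i k) = (\<Sum>k\<le>r i. F k * u (r i - k))" for i
    by (subst suminf_finite[of "{..r i}"]) (auto simp: g_def intro!: sum.cong)
  have "(\<lambda>i. \<Sum>k. f k * g (s i) (Suc k)) \<longlonglongrightarrow> (\<Sum>k. f k * v (Suc k))"
    by (rule tendsto_suminf_mult[where B = B])
      (use f f_pos g_le v in \<open>auto simp: sums_iff less_imp_le\<close>)
  then have "(\<lambda>i. u (r (s i)) - (\<Sum>k<r (s i). f k * u (r (s i) - Suc k)))
      \<longlonglongrightarrow> L - (\<Sum>k. f k * v (Suc k))"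
    unfolding sum_f by (intro tendsto_diff \<open>(\<lambda>i. u (r (s i))) \<longlonglongrightarrow> L\<close>)
  moreover have "(\<lambda>i. u (r (s i)) - (\<Sum>k<r (s i). f k * u (r (s i) - Suc k))) \<longlonglongrightarrow> 0"
    using filterlim_compose[OF ren rs] .
  ultimately have fv: "(\<Sum>k. f k * v (Suc k)) = L"
    using LIMSEQ_unique by fastforce
  have v_ge: "- B \<le> v k" for k
    by (rule tendsto_lowerbound[OF v]) (use g_le in \<open>auto simp: abs_le_iff minus_le_iff\<close>)
  have "summable (\<lambda>k. f k * v (Suc k))"
  proof (rule summable_comparison_test')
    show "summable (\<lambda>k. f k * (\<bar>L\<bar> + B))"
      using f by (intro summable_mult2) (simp add: sums_iff)
    show "norm (f k * v (Suc k)) \<le> f k * (\<bar>L\<bar> + B)" for k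
      using f_pos[of k] v_le[of "Suc k"] v_ge[of "Suc k"] \<open>0 \<le> B\<close>
      by (auto simp: abs_mult intro!: mult_left_mono)
  qed
  \<comment> \<open>The terms are nonnegative because \<open>v (Suc k)\<close> is at most
    \<open>L\<close>, and they sum to 0, so each of them vanishes.\<close>
  then have sm: "(\<lambda>k. f k * L - f k * v (Suc k)) sums (1 * L - L)"
    using f fv by (intro sums_diff sums_mult2) (auto simp: sums_iff)
  have "f k * L - f k * v (Suc k) = 0" for k
    using sm f_pos v_le suminf_eq_zero_iff[of "\<lambda>k. f k * L - f k * v (Suc k)"]
    by (auto simp: sums_iff less_imp_le mult_left_mono)
  then have "v (Suc k) = L" for k
    using f_pos[of k] by (metis eq_iff_diff_eq_0 less_irrefl mult_left_cancel)
  then have v_eq: "v k = L" for k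
    using v0 by (cases k) auto
  have "(\<lambda>i. \<Sum>k. F k * g (s i) k) \<longlonglongrightarrow> (\<Sum>k. F k * v k)"
    by (rule tendsto_suminf_mult[where B = B]) (use F F_nonneg g_le v in \<open>auto simp: sums_iff\<close>)
  moreover have "(\<Sum>k. F k * v k) = m * L"
    unfolding v_eq using F sums_mult2[of F m L] by (auto simp: sums_iff)
  moreover have "(\<lambda>i. \<Sum>k. F k * g (s i) k) \<longlonglongrightarrow> c"
    unfolding sum_F using filterlim_compose[OF inv rs] .
  ultimately have "m * L = c"
    using LIMSEQ_unique by metis
  then have "L = c / m"
    using F(2) by (simp add: field_simps)
  then show ?thesis
    using L by (simp add: X_def)
qed

text \<open>The limsup bound for \<open>u\<close> and for \<open>- u\<close> traps the sequence
  between equal liminf and limsup.\<close>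

lemma renewal_limit:
  fixes f F u :: "nat \<Rightarrow> real"
  assumes "\<And>k. 0 < f k" "f sums 1" "\<And>k. 0 \<le> F k" "F sums m" "m \<noteq> 0" "\<And>n. \<bar>u n\<bar> \<le> B"
    and ren: "(\<lambda>n. u n - (\<Sum>k<n. f k * u (n - Suc k))) \<longlonglongrightarrow> 0"
    and inv: "(\<lambda>n. \<Sum>k\<le>n. F k * u (n - k)) \<longlonglongrightarrow> c"
  shows "u \<longlonglongrightarrow> c / m"
proof -
  have upper: "limsup (\<lambda>n. ereal (u n)) \<le> ereal (c / m)"
    by (rule renewal_limsup_le[OF assms])
  have "limsup (\<lambda>n. ereal (- u n)) \<le> ereal (- c / m)"
  proof (rule renewal_limsup_le[OF assms(1-5)])
    show "\<bar>- u n\<bar> \<le> B" for n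
      using assms(6) by simp
    show "(\<lambda>n. - u n - (\<Sum>k<n. f k * - u (n - Suc k))) \<longlonglongrightarrow> 0"
      using tendsto_minus[OF ren] by (simp add: sum_negf)
    show "(\<lambda>n. \<Sum>k\<le>n. F k * - u (n - k)) \<longlonglongrightarrow> - c"
      using tendsto_minus[OF inv] by (simp add: sum_negf)
  qed
  then have "ereal (c / m) \<le> liminf (\<lambda>n. ereal (u n))"
    using ereal_Limsup_uminus[of sequentially "\<lambda>n. ereal (u n)"]
    by (simp add: ereal_uminus_le_reorder)
  then show ?thesis
    using upper by (intro limsup_le_liminf_real)
qed

section \<open>Tails of summable sequences\<close>

definition tail :: "(nat \<Rightarrow> real) \<Rightarrow> nat \<Rightarrow> real" where
  "tail a k = (\<Sum>j. a (j + Suc k))"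

lemma tail_eq: "a sums s \<Longrightarrow> tail a k = s - sum a {..k}"
  unfolding tail_def lessThan_Suc_atMost[symmetric]
  by (subst suminf_minus_initial_segment) (auto simp: sums_iff)

lemma tail_pos:
  assumes "summable a" "\<And>k. 0 < a k"
  shows "0 < tail a k"
  unfolding tail_def using assms by (intro suminf_pos summable_ignore_initial_segment)

text \<open>This exchanges the order of summation over pairs \<open>k < j\<close>. For a probability
  weight \<open>a\<close>, the choice \<open>c k = 1\<close> gives the mean as the sum of the tail,
  and \<open>c k = k\<close> gives half the second factorial moment.\<close>

lemma sums_weighted_tail:
  fixes a c :: "nat \<Rightarrow> real"
  assumes a: "summable a" "\<And>k. 0 \<le> a k" and c: "\<And>k. 0 \<le> c k"
    and s: "(\<lambda>j. a j * (\<Sum>k<j. c k)) sums s"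
  shows "(\<lambda>k. c k * tail a k) sums s"
proof -
  define C where "C j = (\<Sum>k<j. c k)" for j
  define T where "T N = (\<Sum>j. a (j + N))" for N
  have T: "T N = a N + T (Suc N)" for N
    using suminf_split_head[of "\<lambda>j. a (j + N)"] summable_ignore_initial_segment[OF a(1)]
    by (simp add: T_def)
  have T_nonneg: "0 \<le> T N" for N
    unfolding T_def by (intro suminf_nonneg summable_ignore_initial_segment a)
  have C_mono: "C i \<le> C j" if "i \<le> j" for i j
    unfolding C_def using that c by (intro sum_mono2) auto
  have C_nonneg: "0 \<le> C i" for i
    unfolding C_def by (intro sum_nonneg c)
  \<comment> \<open>Abel summation.\<close>
  have partial: "(\<Sum>k<N. c k * tail a k) = (\<Sum>j<N. a j * C j) + C N * T N" for N
  proof (induction N)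
    case (Suc N)
    have "tail a N = T (Suc N)"
      by (simp add: tail_def T_def)
    moreover have "C (Suc N) = C N + c N"
      by (simp add: C_def)
    ultimately show ?case
      using Suc T[of N] by (simp add: algebra_simps)
  qed (simp add: C_def)
  have sC: "summable (\<lambda>j. a j * C j)"
    using s by (simp add: C_def sums_iff)
  \<comment> \<open>The boundary term vanishes: \<open>C\<close> is nondecreasing, so
    \<open>C N * T N\<close> is at most a remainder of the convergent series of
    \<open>a j * C j\<close>.\<close>
  have "(\<lambda>N. C N * T N) \<longlonglongrightarrow> 0"
  proof (rule tendsto_sandwich[OF _ _ tendsto_const])
    show "(\<lambda>N. \<Sum>j. a (j + N) * C (j + N)) \<longlonglongrightarrow> 0"
      using suminf_exist_split2[OF sC] by simp
    show "\<forall>\<^sub>F N in sequentially. 0 \<le> C N * T N"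
      using C_nonneg T_nonneg by simp
    have "C N * T N \<le> (\<Sum>j. a (j + N) * C (j + N))" for N
    proof -
      have "C N * T N = (\<Sum>j. a (j + N) * C N)"
        unfolding T_def using suminf_mult2[OF summable_ignore_initial_segment[OF a(1)]]
        by (simp add: mult.commute)
      also have "\<dots> \<le> (\<Sum>j. a (j + N) * C (j + N))"
        using a C_mono
        by (intro suminf_le mult_left_mono summable_mult2 summable_ignore_initial_segment[OF a(1)]
            summable_ignore_initial_segment[OF sC]) auto
      finally show ?thesis .
    qed
    then show "\<forall>\<^sub>F N in sequentially. C N * T N \<le> (\<Sum>j. a (j + N) * C (j + N))"
      by simp
  qed
  then have "(\<lambda>N. (\<Sum>j<N. a j * C j) + C N * T N) \<longlonglongrightarrow> s + 0"
    using s by (intro tendsto_add) (simp_all add: sums_def C_def)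
  then show ?thesis
    by (simp add: sums_def partial)
qed

section \<open>The stationary sequence\<close>

text \<open>Stationary weight of the state \<open>n\<close> levels below the full one, normalised to \<open>1\<close> at the full
  state (the \<open>\<pi>\<^sub>n\<close> of the generating function).\<close>

fun level :: "(nat \<Rightarrow> real) \<Rightarrow> nat \<Rightarrow> real" where
  "level r n = (r n + (\<Sum>j<n. tail r (n - j) * level r j)) / r 0"

declare level.simps [simp del]

text \<open>The law of the number of services completed between two arrivals at a never idle server
  when \<rho> = 1. Positivity allows division by \<open>r 0\<close> and makes all renewal weights
  strictly positive.\<close>

locale critical_law =
  fixes r :: "nat \<Rightarrow> real"
  assumes r_pos: "\<And>k. 0 < r k"
    and r_sums: "r sums 1"
    and r_mean: "(\<lambda>k. r k * real k) sums 1"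
begin

lemma tail_r_pos: "0 < tail r k"
  by (rule tail_pos) (use r_sums r_pos in \<open>auto simp: sums_iff\<close>)

text \<open>The tail sums to the mean, so criticality makes it a probability weight again.\<close>

lemma tail_r_sums: "tail r sums 1"
  using sums_weighted_tail[of r "\<lambda>_. 1" 1] r_sums r_pos r_mean by (auto simp: sums_iff less_imp_le)

lemma tail_r_Suc: "tail r k = r (Suc k) + tail r (Suc k)"
  by (simp add: tail_eq[OF r_sums])

lemma tail_r_0: "tail r 0 = 1 - r 0"
  by (simp add: tail_eq[OF r_sums])

lemma tail_tail_Suc: "tail (tail r) k = tail r (Suc k) + tail (tail r) (Suc k)"
  by (simp add: tail_eq[OF tail_r_sums])

lemma tail_tail_0: "tail (tail r) 0 = r 0"
  by (simp add: tail_eq[OF tail_r_sums] tail_r_0)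

lemma tail_tail_pos: "0 < tail (tail r) k"
  by (rule tail_pos) (use tail_r_sums tail_r_pos in \<open>auto simp: sums_iff\<close>)

lemma level_0: "level r 0 = 1"
  using r_pos[of 0] by (subst level.simps) simp

text \<open>For \<open>n > 0\<close> this is the balance of flows between the levels below
  \<open>n\<close> and the others. Upward crossings start at level \<open>n\<close> with no service
  completed; level \<open>j\<close> with \<open>0 < j < n\<close> crosses downward with more than
  \<open>n - j\<close> completions. At the full state the arrival is lost, which shifts the count by
  one: \<open>r n + tail r n\<close> is \<open>tail r (n - 1)\<close>.\<close>

lemma level_mult: "r 0 * level r n = r n + (\<Sum>j<n. tail r (n - j) * level r j)"
  using r_pos[of 0] by (subst (1) level.simps) simp

lemma level_cut: "level r n = r n + (\<Sum>j\<le>n. tail r (n - j) * level r j)"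
  using level_mult[of n] by (simp add: lessThan_Suc_atMost[symmetric] tail_r_0 algebra_simps)

lemma level_nonneg: "0 \<le> level r n"
proof (induction n rule: less_induct)
  case (less n)
  then show ?case
    using r_pos tail_r_pos
    by (subst level.simps) (auto intro!: divide_nonneg_nonneg add_nonneg_nonneg sum_nonneg simp: less_imp_le)
qed

text \<open>Summed form of the renewal equation. Passing from \<open>n\<close> to
  \<open>Suc n\<close> lowers the double tails by exactly the convolution in
  \<open>level_mult\<close>, while the new term is \<open>r 0 * level r (Suc n)\<close>; the net
  gain is \<open>r (Suc n)\<close>.\<close>

lemma level_invariant: "(\<Sum>j\<le>n. tail (tail r) (n - j) * level r j) = sum r {..n}"
proof (induction n)
  case 0
  then show ?case
    by (simp add: tail_tail_0 level_0)
next
  case (Suc n)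
  have "(\<Sum>j\<le>n. tail (tail r) (n - j) * level r j)
      = (\<Sum>j\<le>n. tail r (Suc n - j) * level r j) + (\<Sum>j\<le>n. tail (tail r) (Suc n - j) * level r j)"
    unfolding sum.distrib[symmetric]
    by (intro sum.cong refl, subst tail_tail_Suc) (simp add: Suc_diff_le distrib_right)
  then show ?case
    using Suc level_mult[of "Suc n"] by (simp add: tail_tail_0 lessThan_Suc_atMost)
qed

text \<open>Subtracting two consecutive cut equations recovers the balance equation of a single
  state, read downwards from the full one.\<close>

lemma level_balance: "level r k = r k + (\<Sum>l\<le>k. level r (Suc l) * r (k - l))"
proof -
  have "(\<Sum>j\<le>k. tail r (k - j) * level r j)
      = (\<Sum>j\<le>k. r (Suc k - j) * level r j) + (\<Sum>j\<le>k. tail r (Suc k - j) * level r j)"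
    unfolding sum.distrib[symmetric]
    by (intro sum.cong refl, subst tail_r_Suc) (simp add: Suc_diff_le distrib_right)
  moreover have "(\<Sum>j\<le>Suc k. r (Suc k - j) * level r j)
      = r (Suc k) + (\<Sum>l\<le>k. level r (Suc l) * r (k - l))"
    by (subst sum.atMost_Suc_shift) (simp add: level_0 mult.commute)
  ultimately show ?thesis
    using level_cut[of k] level_mult[of "Suc k"] unfolding lessThan_Suc_atMost sum.atMost_Suc by simp
qed

text \<open>The equation at \<open>k\<close> contains \<open>x (Suc k)\<close> with the nonzero
  coefficient \<open>r 0\<close>, so it determines that value from the earlier ones.\<close>

lemma level_unique:
  assumes "\<And>k. k < n \<Longrightarrow> x k = x 0 * r k + (\<Sum>l\<le>k. x (Suc l) * r (k - l))" "k \<le> n"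
  shows "x k = x 0 * level r k"
  using \<open>k \<le> n\<close>
proof (induction k rule: less_induct)
  case (less k)
  show ?case
  proof (cases k)
    case 0
    then show ?thesis
      by (simp add: level_0)
  next
    case (Suc k')
    have "x k' = x 0 * r k' + (\<Sum>l\<le>k'. x (Suc l) * r (k' - l))"
      using less.prems Suc by (intro assms(1)) auto
    have IH: "x (Suc l) = x 0 * level r (Suc l)" if "l < k'" for l
      using that Suc less.prems by (intro less.IH) auto
    note \<open>x k' = _\<close>
    also have "(\<Sum>l\<le>k'. x (Suc l) * r (k' - l))
        = (\<Sum>l<k'. x 0 * level r (Suc l) * r (k' - l)) + x k * r 0"
      unfolding lessThan_Suc_atMost[symmetric] sum.lessThan_Suc
      using Suc IH by simp
    finally have "x k * r 0 = x k' - x 0 * r k' - x 0 * (\<Sum>l<k'. level r (Suc l) * r (k' - l))"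
      by (simp add: sum_distrib_left mult.assoc)
    moreover have "x k' = x 0 * level r k'"
      using less.IH[of k'] less.prems Suc by simp
    moreover have "level r k * r 0
        = level r k' - r k' - (\<Sum>l<k'. level r (Suc l) * r (k' - l))"
      using level_balance[of k'] Suc by (simp add: lessThan_Suc_atMost[symmetric])
    ultimately have "x k * r 0 = x 0 * (level r k * r 0)"
      by (simp only: right_diff_distrib)
    then show ?thesis
      using r_pos[of 0] by simp
  qed
qed

text \<open>Apply \<open>renewal_limit\<close> with kernel \<open>tail r (Suc k) / r 0\<close>,
  vanishing perturbation \<open>r n / r 0\<close>, and the double tail, of total mass
  \<open>m / 2\<close>, in the conserved quantity, whose limit is 1.\<close>

lemma level_tendsto:
  assumes m: "(\<lambda>k. r k * (real k * (real k - 1))) sums m"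
  shows "level r \<longlonglongrightarrow> 2 / m"
proof -
  have "2 * (\<Sum>k<j. real k) = real j * (real j - 1)" for j
    by (induction j) (auto simp: algebra_simps)
  then have "r j * (\<Sum>k<j. real k) = r j * (real j * (real j - 1)) / 2" for j
    by (metis mult.left_commute nonzero_mult_div_cancel_left zero_neq_numeral)
  then have kt: "(\<lambda>k. real k * tail r k) sums (m / 2)"
    using r_pos r_sums sums_divide[OF m, of 2]
    by (intro sums_weighted_tail) (simp_all only: less_imp_le sums_summable of_nat_0_le_iff)
  have tt: "tail (tail r) sums (m / 2)"
    using sums_weighted_tail[of "tail r" "\<lambda>_. 1" "m / 2"] kt tail_r_sums tail_r_pos
    by (auto simp: sums_iff less_imp_le mult.commute)
  have "0 < m / 2"
    using tt suminf_pos[of "tail (tail r)"] tail_tail_pos by (simp add: sums_iff)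
  have r_lim: "r \<longlonglongrightarrow> 0"
    using r_sums by (intro summable_LIMSEQ_zero) (simp add: sums_iff)
  have "level r \<longlonglongrightarrow> 1 / (m / 2)"
  proof (rule renewal_limit)
    show "0 < tail r (Suc k) / r 0" for k
      using tail_r_pos r_pos by simp
    have "(\<lambda>k. tail r (Suc k)) sums (1 - tail r 0)"
      using tail_r_sums by (subst sums_Suc_iff) simp
    then have "(\<lambda>k. tail r (Suc k) / r 0) sums ((1 - tail r 0) / r 0)"
      by (rule sums_divide)
    then show "(\<lambda>k. tail r (Suc k) / r 0) sums 1"
      using r_pos[of 0] by (simp add: tail_r_0)
    show "0 \<le> tail (tail r) k" for k
      using tail_tail_pos by (simp add: less_imp_le)
    show "tail (tail r) sums (m / 2)" "m / 2 \<noteq> 0"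
      using tt \<open>0 < m / 2\<close> by auto
    show "\<bar>level r n\<bar> \<le> 1 / r 0" for n
    proof -
      \<comment> \<open>The left side is the term \<open>j = n\<close> of the invariant, whose terms
        are all nonnegative.\<close>
      have "r 0 * level r n \<le> (\<Sum>j\<le>n. tail (tail r) (n - j) * level r j)"
        using member_le_sum[of n "{..n}" "\<lambda>j. tail (tail r) (n - j) * level r j"]
          tail_tail_pos level_nonneg by (simp add: tail_tail_0 less_imp_le)
      also have "\<dots> \<le> 1"
        using sum_le_suminf[of r "{..n}"] r_sums r_pos
        by (simp add: level_invariant sums_iff less_imp_le)
      finally show ?thesis
        using r_pos[of 0] level_nonneg by (simp add: field_simps)
    qed
    have "level r n - (\<Sum>k<n. tail r (Suc k) / r 0 * level r (n - Suc k)) = r n / r 0" for n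
    proof -
      have "(\<Sum>k<n. tail r (Suc k) * level r (n - Suc k)) = (\<Sum>j<n. tail r (n - j) * level r j)"
        using sum.nat_diff_reindex[of "\<lambda>j. tail r (n - j) * level r j" n]
        by (auto intro!: sum.cong)
      then show ?thesis
        by (subst level.simps) (simp add: add_divide_distrib flip: sum_divide_distrib)
    qed
    then show "(\<lambda>n. level r n - (\<Sum>k<n. tail r (Suc k) / r 0 * level r (n - Suc k))) \<longlonglongrightarrow> 0"
      using tendsto_divide[OF r_lim tendsto_const[of "r 0"]] r_pos[of 0] by simp
    have "(\<Sum>k\<le>n. tail (tail r) k * level r (n - k)) = sum r {..n}" for n
      using sum.nat_diff_reindex[of "\<lambda>j. tail (tail r) (n - j) * level r j" "Suc n"]
      by (subst level_invariant[symmetric]) (auto simp: lessThan_Suc_atMost intro!: sum.cong)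
    then show "(\<lambda>n. \<Sum>k\<le>n. tail (tail r) k * level r (n - k)) \<longlonglongrightarrow> 1"
      using r_sums by (simp add: sums_def_le)
  qed
  then show ?thesis
    by simp
qed

end

section \<open>Stationary law of the loss chain\<close>

lemma (in critical_law) stationary_flow_iff:
  fixes P :: "nat \<Rightarrow> nat \<Rightarrow> real" and x :: "nat \<Rightarrow> real"
  assumes P: "\<And>i j. i \<le> n \<Longrightarrow> 0 < j \<Longrightarrow>
      P i j = (if j \<le> after_arrival n i then r (after_arrival n i - j) else 0)"
    and P_sum: "\<And>i. i \<le> n \<Longrightarrow> (\<Sum>j\<le>n. P i j) = 1"
  shows "(\<forall>j\<le>n. x j = (\<Sum>i\<le>n. x i * P i j)) \<longleftrightarrow> (\<forall>k\<le>n. x (n - k) = x n * level r k)"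
proof -
  \<comment> \<open>The state \<open>n - Suc l\<close> moves to \<open>n - l\<close> on arrival,
    whereas the full state stays at \<open>n\<close>; this is the source of the separate term
    \<open>x n * r k\<close>.\<close>
  have flow: "(\<Sum>i\<le>n. x i * P i (n - k)) = x n * r k + (\<Sum>l\<le>k. x (n - Suc l) * r (k - l))"
    if "k < n" for k
  proof -
    have "(\<Sum>i<n. x i * P i (n - k)) = (\<Sum>l<n. x (n - Suc l) * P (n - Suc l) (n - k))"
      by (rule sum.nat_diff_reindex[symmetric])
    also have "\<dots> = (\<Sum>l<n. if l \<le> k then x (n - Suc l) * r (k - l) else 0)"
    proof (intro sum.cong refl)
      fix l assume "l \<in> {..<n}"
      then have "after_arrival n (n - Suc l) = n - l"
        by (auto simp: after_arrival_def)
      moreover have "l \<le> k \<Longrightarrow> n - l - (n - k) = k - l"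
        using that by simp
      moreover have "n - k \<le> n - l \<longleftrightarrow> l \<le> k"
        using that by auto
      ultimately show "x (n - Suc l) * P (n - Suc l) (n - k)
          = (if l \<le> k then x (n - Suc l) * r (k - l) else 0)"
        using that P[of "n - Suc l" "n - k"] by auto
    qed
    also have "\<dots> = (\<Sum>l\<in>{..<n} \<inter> {l. l \<le> k}. x (n - Suc l) * r (k - l))"
      by (simp add: sum.inter_restrict)
    also have "{..<n} \<inter> {l. l \<le> k} = {..k}"
      using that by auto
    finally have "(\<Sum>i<n. x i * P i (n - k)) = (\<Sum>l\<le>k. x (n - Suc l) * r (k - l))" .
    moreover have "P n (n - k) = r k"
      using that P[of n "n - k"] by (simp add: after_arrival_def)
    ultimately show ?thesis
      by (simp add: lessThan_Suc_atMost[symmetric])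
  qed
  show ?thesis
  proof
    assume L: "\<forall>j\<le>n. x j = (\<Sum>i\<le>n. x i * P i j)"
    show "\<forall>k\<le>n. x (n - k) = x n * level r k"
    proof (intro allI impI)
      fix k assume "k \<le> n"
      have "x (n - k) = x (n - 0) * r k + (\<Sum>l\<le>k. x (n - Suc l) * r (k - l))" if "k < n" for k
        using L[rule_format, of "n - k"] flow[OF that] by simp
      from level_unique[of n "\<lambda>k. x (n - k)", OF this \<open>k \<le> n\<close>]
      show "x (n - k) = x n * level r k"
        by simp
    qed
  next
    assume R: "\<forall>k\<le>n. x (n - k) = x n * level r k"
    have pos: "x j = (\<Sum>i\<le>n. x i * P i j)" if "0 < j" "j \<le> n" for j
    proof -
      define k where "k = n - j"
      then have k: "k < n" "j = n - k"
        using that by auto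
      have "(\<Sum>l\<le>k. x (n - Suc l) * r (k - l)) = x n * (\<Sum>l\<le>k. level r (Suc l) * r (k - l))"
        unfolding sum_distrib_left using R k by (intro sum.cong) auto
      then show ?thesis
        unfolding k(2) flow[OF k(1)] using R k level_balance[of k]
        by (simp flip: distrib_left)
    qed
    \<comment> \<open>The equation for state 0, where departures are cut off by emptiness, follows
      from the others because the rows of \<open>P\<close> sum to 1.\<close>
    have "(\<Sum>j\<le>n. \<Sum>i\<le>n. x i * P i j) = (\<Sum>i\<le>n. x i * (\<Sum>j\<le>n. P i j))"
      by (subst sum.swap) (simp add: sum_distrib_left)
    also have "\<dots> = (\<Sum>j\<le>n. x j)"
      by (simp add: P_sum)
    finally have "x 0 = (\<Sum>i\<le>n. x i * P i 0)"
      using pos by (simp add: sum.atMost_shift)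
    then show "\<forall>j\<le>n. x j = (\<Sum>i\<le>n. x i * P i j)"
      using pos by (metis not_gr_zero)
  qed
qed

text \<open>The balance equations fix the stationary law up to its mass at \<open>n\<close>, and
  normalisation fixes that mass. Hence the law \<open>w\<close> is the unique one selected by
  \<open>THE\<close>, and it gives the full state \<open>level r 0 / S\<close>, where
  \<open>level r 0 = 1\<close>.\<close>

lemma (in critical_law) loss_prob_eq:
  assumes P: "\<And>i j. i \<le> n \<Longrightarrow> 0 < j \<Longrightarrow> trans_prob A \<mu> n i j
      = (if j \<le> after_arrival n i then r (after_arrival n i - j) else 0)"
    and P_sum: "\<And>i. i \<le> n \<Longrightarrow> (\<Sum>j\<le>n. trans_prob A \<mu> n i j) = 1"
  shows "loss_prob A \<mu> n = 1 / (\<Sum>k\<le>n. level r k)"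
proof -
  define S where "S = (\<Sum>k\<le>n. level r k)"
  have "level r 0 \<le> S"
    unfolding S_def by (rule member_le_sum) (auto simp: level_nonneg)
  then have "0 < S"
    by (simp add: level_0)
  define w where "w j = (if j \<le> n then level r (n - j) / S else 0)" for j
  have rev: "(\<Sum>j\<le>n. y (n - j)) = (\<Sum>j\<le>n. y j)" for y :: "nat \<Rightarrow> real"
    using sum.nat_diff_reindex[of y "Suc n"] by (simp add: lessThan_Suc_atMost)
  have w_nonneg: "0 \<le> w j" for j
    using \<open>0 < S\<close> by (simp add: w_def level_nonneg)
  have "(\<integral>\<^sup>+ j. ennreal (w j) \<partial>count_space UNIV) = (\<Sum>j\<le>n. ennreal (w j))"
    by (rule nn_integral_count_space') (auto simp: w_def)
  also have "\<dots> = ennreal (\<Sum>j\<le>n. w j)"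
    by (simp add: w_nonneg)
  also have "(\<Sum>j\<le>n. w j) = 1"
    using rev[of "level r"] \<open>0 < S\<close> by (simp add: w_def S_def flip: sum_divide_distrib)
  finally have w_pmf: "pmf (embed_pmf w) = w"
    using w_nonneg by (intro ext pmf_embed_pmf) auto
  have stat: "stationary A \<mu> n q \<longleftrightarrow>
      set_pmf q \<subseteq> {..n} \<and> (\<forall>k\<le>n. pmf q (n - k) = pmf q n * level r k)" for q
    unfolding stationary_def by (subst stationary_flow_iff[OF P P_sum]) auto
  have stat_n: "pmf q n = 1 / S" if "stationary A \<mu> n q" for q
  proof -
    have "1 = (\<Sum>j\<le>n. pmf q (n - j))"
      using that unfolding rev by (simp add: stat sum_pmf_eq_1)
    also have "\<dots> = (\<Sum>j\<le>n. pmf q n * level r j)"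
      using that by (intro sum.cong) (auto simp: stat)
    finally show ?thesis
      using \<open>0 < S\<close> by (simp add: S_def field_simps flip: sum_distrib_left)
  qed
  have "(THE q. stationary A \<mu> n q) = embed_pmf w"
  proof (rule the_equality)
    show "stationary A \<mu> n (embed_pmf w)"
      unfolding stat by (auto simp: set_pmf_eq w_pmf w_def level_0 split: if_splits)
  next
    fix q assume q: "stationary A \<mu> n q"
    show "q = embed_pmf w"
    proof (rule pmf_eqI)
      fix j
      show "pmf q j = pmf (embed_pmf w) j"
      proof (cases "j \<le> n")
        case True
        then show ?thesis
          using q[unfolded stat, THEN conjunct2, rule_format, of "n - j"] stat_n[OF q]
          by (simp add: w_pmf w_def)
      next
        case False
        then have "j \<notin> set_pmf q"
          using q by (auto simp: stat)
        then show ?thesis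
          using False by (simp add: w_pmf w_def set_pmf_iff)
      qed
    qed
  qed
  then show ?thesis
    by (simp add: loss_prob_def w_pmf w_def S_def level_0)
qed

section \<open>Poisson mixtures and transition probabilities\<close>

definition poisson_weight :: "nat \<Rightarrow> real \<Rightarrow> real" where
  "poisson_weight k y = exp (- y) * y ^ k / fact k"

text \<open>This index shift reduces the mean to the total mass and the second factorial moment to
  the mean.\<close>

lemma poisson_weight_Suc: "poisson_weight (Suc k) y * real (Suc k) = y * poisson_weight k y"
  by (simp add: poisson_weight_def field_simps del: of_nat_Suc)

lemma poisson_weight_sums: "(\<lambda>k. poisson_weight k y) sums 1"
  using sums_mult[OF exp_converges[of y], of "exp (- y)"]
  by (simp add: poisson_weight_def scaleR_conv_of_real divide_inverse mult_ac exp_minus)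

lemma poisson_weight_mean: "(\<lambda>k. poisson_weight k y * real k) sums y"
proof -
  have "(\<lambda>k. poisson_weight (Suc k) y * real (Suc k)) sums (y * 1)"
    unfolding poisson_weight_Suc by (intro sums_mult poisson_weight_sums)
  then show ?thesis
    by (subst (asm) sums_Suc_iff) simp
qed

lemma poisson_weight_factorial_moment:
  "(\<lambda>k. poisson_weight k y * (real k * (real k - 1))) sums y\<^sup>2"
proof -
  have "(\<lambda>k. y * (poisson_weight k y * real k)) sums (y * y)"
    by (intro sums_mult poisson_weight_mean)
  moreover have "y * (poisson_weight k y * real k)
      = poisson_weight (Suc k) y * (real (Suc k) * (real (Suc k) - 1))" for k
    using poisson_weight_Suc[of k y] by (simp flip: mult.assoc)
  ultimately have "(\<lambda>k. poisson_weight (Suc k) y * (real (Suc k) * (real (Suc k) - 1))) sums (y * y)"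
    by simp
  then show ?thesis
    by (subst (asm) sums_Suc_iff) (simp add: power2_eq_square)
qed

text \<open>The partial sums are nonnegative and bounded by \<open>g\<close>, which serves as the
  dominating function. Almost everywhere hypotheses suit Poisson weights, whose sign is controlled
  only at nonnegative arguments.\<close>

lemma integral_sums_nonneg:
  fixes f :: "nat \<Rightarrow> 'a \<Rightarrow> real"
  assumes f[measurable]: "\<And>k. f k \<in> borel_measurable M"
    and f_nonneg: "AE x in M. \<forall>k. 0 \<le> f k x"
    and fg: "AE x in M. (\<lambda>k. f k x) sums g x" and g: "integrable M g"
  shows "integrable M (f k)" "(\<lambda>k. \<integral>x. f k x \<partial>M) sums (\<integral>x. g x \<partial>M)"
proof -
  have partial: "AE x in M. \<forall>n. norm (\<Sum>k<n. f k x) \<le> g x"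
    using f_nonneg fg
  proof eventually_elim
    case (elim x)
    then show ?case
      using sum_le_suminf[of "\<lambda>k. f k x"] by (auto simp: sum_nonneg sums_iff)
  qed
  have int: "integrable M (f k)" for k
  proof (rule Bochner_Integration.integrable_bound[OF g f])
    show "AE x in M. norm (f k x) \<le> norm (g x)"
      using f_nonneg fg
    proof eventually_elim
      case (elim x)
      then show ?case
        using sum_le_suminf[of "\<lambda>k. f k x" "{k}"] by (auto simp: sums_iff)
    qed
  qed
  then show "integrable M (f k)" .
  have "(\<lambda>n. \<integral>x. (\<Sum>k<n. f k x) \<partial>M) \<longlonglongrightarrow> (\<integral>x. g x \<partial>M)"
  proof (rule integral_dominated_convergence[where w = g])
    show "AE x in M. (\<lambda>n. \<Sum>k<n. f k x) \<longlonglongrightarrow> g x"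
      using fg by (simp add: sums_def)
    show "AE x in M. norm (\<Sum>k<n. f k x) \<le> g x" for n
      using partial by eventually_elim simp
  qed (use g in auto)
  then show "(\<lambda>k. \<integral>x. f k x \<partial>M) sums (\<integral>x. g x \<partial>M)"
    by (simp add: sums_def Bochner_Integration.integral_sum int)
qed

section \<open>Exponential service times and departure counts\<close>

definition service_measure :: "real \<Rightarrow> (nat \<Rightarrow> real) measure" where
  "service_measure \<mu> = (\<Pi>\<^sub>M k\<in>UNIV. density lborel (exponential_density \<mu>))"

lemma sets_service_measure [measurable_cong]:
  "sets (service_measure \<mu>) = sets (\<Pi>\<^sub>M k\<in>UNIV. borel)"
  unfolding service_measure_def by (intro sets_PiM_cong) auto

lemma space_service_measure: "space (service_measure \<mu>) = UNIV"
  by (simp add: service_measure_def space_PiM PiE_UNIV_domain)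

lemma prob_space_service_measure: "0 < \<mu> \<Longrightarrow> prob_space (service_measure \<mu>)"
  unfolding service_measure_def by (intro prob_space_PiM prob_space_exponential_density)

lemma distr_service_measure:
  assumes "0 < \<mu>"
  shows "distr (service_measure \<mu>) borel (\<lambda>s. s i) = density lborel (exponential_density \<mu>)"
proof -
  have "distr (service_measure \<mu>) borel (\<lambda>s. s i)
      = distr (service_measure \<mu>) (density lborel (exponential_density \<mu>)) (\<lambda>s. s i)"
    by (intro distr_cong) auto
  also have "\<dots> = density lborel (exponential_density \<mu>)"
    unfolding service_measure_def
    by (intro distr_PiM_component prob_space_exponential_density assms) simp
  finally show ?thesis .
qed

lemma indep_vars_service_measure:
  assumes "0 < \<mu>"
  shows "prob_space.indep_vars (service_measure \<mu>) (\<lambda>_. borel) (\<lambda>i s. s i) I"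
proof -
  interpret prob_space "service_measure \<mu>"
    by (rule prob_space_service_measure[OF assms])
  have "distr (service_measure \<mu>) (\<Pi>\<^sub>M i\<in>UNIV. borel) (\<lambda>s. s) = service_measure \<mu>"
    by (intro distr_id2 sets_service_measure[symmetric])
  then have "indep_vars (\<lambda>_. borel) (\<lambda>i s. s i) UNIV"
    by (subst indep_vars_iff_distr_eq_PiM')
      (simp_all add: distr_service_measure[OF assms] restrict_def flip: service_measure_def)
  then show ?thesis
    by (rule indep_vars_subset) simp
qed

text \<open>A sum of \<open>d\<close> independent exponentials is Erlang, and its distribution
  function is a Poisson tail. The empty sum is treated separately, since the Erlang shape index is
  \<open>d - 1\<close>.\<close>

lemma prob_service_sum_le:
  assumes "0 < \<mu>" "0 \<le> t"
  shows "measure (service_measure \<mu>) {s. (\<Sum>i<d. s i) \<le> t} = 1 - (\<Sum>k<d. poisson_weight k (\<mu> * t))"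
proof (cases d)
  case 0
  then show ?thesis
    using assms prob_space.prob_space[OF prob_space_service_measure[OF \<open>0 < \<mu>\<close>]]
    by (simp add: space_service_measure)
next
  case (Suc d')
  interpret prob_space "service_measure \<mu>"
    by (rule prob_space_service_measure) fact
  have "distributed (service_measure \<mu>) lborel (\<lambda>s. s i) (exponential_density \<mu>)" for i
    using distr_service_measure[OF assms(1), of i]
    unfolding distributed_def by (auto simp: distr_def)
  then have "distributed (service_measure \<mu>) lborel (\<lambda>s. \<Sum>i\<in>{..<d}. s i)
      (erlang_density (card {..<d} - 1) \<mu>)"
    using Suc assms indep_vars_service_measure by (intro exponential_distributed_sum) auto
  then have "prob {s \<in> space (service_measure \<mu>). (\<Sum>i<d. s i) \<le> t} = erlang_CDF (card {..<d} - 1) \<mu> t"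
    using assms by (intro erlang_distributed_le)
  then show ?thesis
    using Suc assms
    by (simp add: space_service_measure erlang_CDF_def poisson_weight_def lessThan_Suc_atMost mult_ac)
qed

lemma AE_service_nonneg:
  assumes "0 < \<mu>"
  shows "AE s in service_measure \<mu>. \<forall>i. 0 \<le> s i"
proof (subst AE_all_countable, rule allI)
  fix i
  have "AE x in density lborel (exponential_density \<mu>). 0 \<le> x"
    by (subst AE_density) (auto simp: exponential_density_def)
  then show "AE s in service_measure \<mu>. 0 \<le> s i"
    unfolding service_measure_def
    by (intro AE_PiM_component prob_space_exponential_density assms) auto
qed

lemma departures_le: "departures m t s \<le> m"
proof -
  have "card {k \<in> {1..m}. (\<Sum>i<k. s i) \<le> t} \<le> card {1..m}"
    by (intro card_mono) auto
  then show ?thesis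
    by (simp add: departures_def)
qed

text \<open>Nonnegative service times make the departure epochs nondecreasing, so the departures up
  to \<open>t\<close> form an initial segment of \<open>{1..m}\<close>. The bound
  \<open>d < m\<close> keeps departure \<open>Suc d\<close> within that range.\<close>

lemma departures_eq_iff:
  assumes s: "\<And>i. 0 \<le> s i" and "0 \<le> t" "d < m"
  shows "departures m t s = d \<longleftrightarrow> (\<Sum>i<d. s i) \<le> t \<and> \<not> (\<Sum>i<Suc d. s i) \<le> t"
proof -
  define K where "K = {k \<in> {1..m}. (\<Sum>i<k. s i) \<le> t}"
  have mono: "(\<Sum>i<k. s i) \<le> (\<Sum>i<l. s i)" if "k \<le> l" for k l
    using that s by (intro sum_mono2) auto
  have ge: "e \<le> card K \<longleftrightarrow> (\<Sum>i<e. s i) \<le> t" if "e \<le> m" for e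
  proof
    assume "(\<Sum>i<e. s i) \<le> t"
    moreover have "(\<Sum>i<k. s i) \<le> (\<Sum>i<e. s i)" if "k \<in> {1..e}" for k
      using that by (intro mono) simp
    ultimately have "{1..e} \<subseteq> K"
      using that unfolding K_def by force
    then have "card {1..e} \<le> card K"
      by (intro card_mono) (auto simp: K_def)
    then show "e \<le> card K"
      by simp
  next
    assume "e \<le> card K"
    show "(\<Sum>i<e. s i) \<le> t"
    proof (rule ccontr)
      assume *: "\<not> (\<Sum>i<e. s i) \<le> t"
      then have "0 < e"
        using \<open>0 \<le> t\<close> by (cases e) auto
      have "K \<subseteq> {1..<e}"
      proof
        fix k assume k: "k \<in> K"
        have "\<not> e \<le> k"
          using k * mono[of e k] by (auto simp: K_def)
        then show "k \<in> {1..<e}"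
          using k by (auto simp: K_def)
      qed
      then have "card K \<le> card {1..<e}"
        by (intro card_mono) auto
      then show False
        using \<open>e \<le> card K\<close> \<open>0 < e\<close> by simp
    qed
  qed
  have "departures m t s = d \<longleftrightarrow> d \<le> card K \<and> \<not> Suc d \<le> card K"
    by (auto simp: departures_def K_def)
  then show ?thesis
    using ge[of d] ge[of "Suc d"] \<open>d < m\<close> by simp
qed

lemma measurable_departures [measurable]:
  "(\<lambda>(t, s). departures m t s) \<in> measurable (borel \<Otimes>\<^sub>M (\<Pi>\<^sub>M k\<in>UNIV. borel)) (count_space UNIV)"
proof -
  have "departures m t s = (\<Sum>k\<in>{1..m}. if (\<Sum>i<k. s i) \<le> t then 1 else 0)" for t s
    unfolding departures_def by (simp add: sum.If_cases Int_def)
  then show ?thesis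
    by simp
qed

lemma prob_departures:
  assumes "0 < \<mu>" "0 \<le> t" "d < m"
  shows "measure (service_measure \<mu>) {s. departures m t s = d} = poisson_weight d (\<mu> * t)"
proof -
  interpret prob_space "service_measure \<mu>"
    by (rule prob_space_service_measure) fact
  have sum_le_sets: "{s. (\<Sum>i<k. s i) \<le> t} \<in> sets (service_measure \<mu>)" for k
  proof -
    have "{s \<in> space (service_measure \<mu>). (\<Sum>i<k. s i) \<le> t} \<in> sets (service_measure \<mu>)"
      by measurable
    then show ?thesis
      by (simp add: space_service_measure)
  qed
  have [measurable]: "{s. departures m t s = d} \<in> sets (service_measure \<mu>)"
  proof -
    have "(\<lambda>s. departures m t s) \<in> measurable (service_measure \<mu>) (count_space UNIV)"
      using measurable_compose[OF measurable_Pair1'[of t borel] measurable_departures[of m]]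
      by simp
    then have "{s \<in> space (service_measure \<mu>). departures m t s = d} \<in> sets (service_measure \<mu>)"
      by measurable
    then show ?thesis
      by (simp add: space_service_measure)
  qed
  let ?E = "\<lambda>k. {s. (\<Sum>i<k. s i) \<le> t}"
  \<comment> \<open>The events \<open>?E\<close> are nested only where the service times are
    nonnegative, that is almost surely; hence the intersection before taking the difference.\<close>
  have "prob {s. departures m t s = d} = prob (?E d - (?E (Suc d) \<inter> ?E d))"
    using AE_service_nonneg[OF assms(1)] sum_le_sets
    by (intro finite_measure_eq_AE) (auto simp: departures_eq_iff[OF _ assms(2,3)] simp del: sum.lessThan_Suc)
  also have "\<dots> = prob (?E d) - prob (?E (Suc d) \<inter> ?E d)"
    by (intro finite_measure_Diff sets.Int sum_le_sets) auto
  also have "prob (?E (Suc d) \<inter> ?E d) = prob (?E (Suc d))"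
  proof (rule finite_measure_eq_AE)
    show "AE s in service_measure \<mu>. s \<in> ?E (Suc d) \<inter> ?E d \<longleftrightarrow> s \<in> ?E (Suc d)"
      using AE_service_nonneg[OF assms(1)]
    proof eventually_elim
      case (elim s)
      then have "0 \<le> s d"
        by simp
      then show ?case
        by auto
    qed
  qed (intro sets.Int sum_le_sets)+
  also have "prob (?E d) - prob (?E (Suc d)) = poisson_weight d (\<mu> * t)"
    by (simp only: prob_service_sum_le[OF assms(1,2)]) simp
  finally show ?thesis .
qed

section \<open>Transition probabilities as Poisson mixtures\<close>

context
  fixes A :: "real measure" and \<mu> :: real
  assumes A: "real_distribution A" and A_nonneg: "AE x in A. 0 \<le> x" and \<mu>: "0 < \<mu>"
begin

interpretation A: real_distribution A by (rule A)

interpretation S: prob_space "service_measure \<mu>" by (rule prob_space_service_measure[OF \<mu>])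

interpretation AS: pair_prob_space A "service_measure \<mu>" ..

lemma cycle_measure_eq: "cycle_measure A \<mu> = A \<Otimes>\<^sub>M service_measure \<mu>"
  by (simp add: cycle_measure_def service_measure_def)

lemma trans_event_sets:
  "{(t, s) \<in> space (cycle_measure A \<mu>). m - departures m t s = j} \<in> sets (cycle_measure A \<mu>)"
proof -
  have [measurable]: "(\<lambda>x. departures m (fst x) (snd x)) \<in> measurable (cycle_measure A \<mu>) (count_space UNIV)"
    using measurable_departures[of m] unfolding cycle_measure_eq
    by (subst measurable_cong_sets[OF sets_pair_measure_cong[OF A.events_eq_borel sets_service_measure] refl])
      (simp add: split_beta')
  have "{x \<in> space (cycle_measure A \<mu>). m - departures m (fst x) (snd x) = j} \<in> sets (cycle_measure A \<mu>)"
    by measurable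
  then show ?thesis
    by (simp add: split_beta')
qed

lemma trans_prob_sum: "i \<le> n \<Longrightarrow> (\<Sum>j\<le>n. trans_prob A \<mu> n i j) = 1"
proof -
  let ?m = "after_arrival n i"
  let ?X = "\<lambda>j. {(t, s) \<in> space (cycle_measure A \<mu>). ?m - departures ?m t s = j}"
  have "(\<Sum>j\<le>n. trans_prob A \<mu> n i j) = measure (cycle_measure A \<mu>) (\<Union>j\<in>{..n}. ?X j)"
    unfolding trans_prob_def
    using trans_event_sets AS.finite_measure_axioms
    by (intro finite_measure.finite_measure_finite_Union[symmetric])
      (auto simp: disjoint_family_on_def cycle_measure_eq)
  also have "(\<Union>j\<in>{..n}. ?X j) = space (cycle_measure A \<mu>)"
    by (auto simp: after_arrival_def)
  also have "measure (cycle_measure A \<mu>) \<dots> = 1"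
    by (simp add: cycle_measure_eq AS.prob_space)
  finally show ?thesis .
qed

text \<open>Condition on the interarrival time by Fubini. A target \<open>j > 0\<close> means fewer
  departures than customers present, so the count has its Poisson probability, unaffected by the
  system emptying.\<close>

lemma trans_prob_eq:
  assumes "i \<le> n" "0 < j"
  shows "trans_prob A \<mu> n i j = (if j \<le> after_arrival n i
      then \<integral>x. poisson_weight (after_arrival n i - j) (\<mu> * x) \<partial>A else 0)"
proof -
  let ?m = "after_arrival n i"
  let ?X = "{(t, s) \<in> space (cycle_measure A \<mu>). ?m - departures ?m t s = j}"
  show ?thesis
  proof (cases "j \<le> ?m")
    case False
    then have "?X = {}"
      by auto
    then have "trans_prob A \<mu> n i j = measure (cycle_measure A \<mu>) {}"
      unfolding trans_prob_def by (rule arg_cong)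
    then show ?thesis
      using False by simp
  next
    case True
    have eq: "?m - departures ?m t s = j \<longleftrightarrow> departures ?m t s = ?m - j" for t s
      using True departures_le[of ?m t s] \<open>0 < j\<close> by auto
    have X: "?X \<in> sets (A \<Otimes>\<^sub>M service_measure \<mu>)"
      using trans_event_sets unfolding cycle_measure_eq .
    have slice: "Pair t -` ?X = {s. departures ?m t s = ?m - j}" for t
      by (auto simp: cycle_measure_eq space_pair_measure space_service_measure eq)
    have "AE t in A. emeasure (service_measure \<mu>) (Pair t -` ?X)
        = ennreal (poisson_weight (?m - j) (\<mu> * t))"
      using A_nonneg
    proof eventually_elim
      case (elim t)
      then show ?case
        using True \<open>0 < j\<close> prob_departures[OF \<mu> elim, of "?m - j" ?m]
        unfolding slice by (simp add: S.emeasure_eq_measure)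
    qed
    then have "emeasure (cycle_measure A \<mu>) ?X = (\<integral>\<^sup>+t. ennreal (poisson_weight (?m - j) (\<mu> * t)) \<partial>A)"
      using X unfolding cycle_measure_eq
      by (subst S.emeasure_pair_measure_alt) (auto intro: nn_integral_cong_AE)
    moreover have "AE t in A. 0 \<le> poisson_weight (?m - j) (\<mu> * t)"
      using A_nonneg by eventually_elim (use \<mu> in \<open>simp add: poisson_weight_def\<close>)
    ultimately show ?thesis
      using True unfolding trans_prob_def measure_def
      by (subst integral_eq_nn_integral) (auto simp: poisson_weight_def)
  qed
qed

text \<open>Integrating a Poisson moment identity term by term over the interarrival law transfers
  it to the mixture.\<close>

lemma poisson_mixture_sums:
  assumes c: "\<And>k. 0 \<le> c k" and g: "\<And>y. (\<lambda>k. poisson_weight k y * c k) sums g y"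
    and "integrable A (\<lambda>x. g (\<mu> * x))"
  shows "integrable A (\<lambda>x. poisson_weight k (\<mu> * x) * c k)"
    and "(\<lambda>k. (\<integral>x. poisson_weight k (\<mu> * x) \<partial>A) * c k) sums (\<integral>x. g (\<mu> * x) \<partial>A)"
proof -
  have "AE x in A. \<forall>k. 0 \<le> poisson_weight k (\<mu> * x) * c k"
    using A_nonneg by eventually_elim (use \<mu> c in \<open>simp add: poisson_weight_def\<close>)
  then have *: "integrable A (\<lambda>x. poisson_weight k (\<mu> * x) * c k)"
    "(\<lambda>k. \<integral>x. poisson_weight k (\<mu> * x) * c k \<partial>A) sums (\<integral>x. g (\<mu> * x) \<partial>A)" for k
    using integral_sums_nonneg[of "\<lambda>k x. poisson_weight k (\<mu> * x) * c k" A "\<lambda>x. g (\<mu> * x)"] assms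
    by (auto simp: poisson_weight_def)
  show "integrable A (\<lambda>x. poisson_weight k (\<mu> * x) * c k)"
    by (rule *)
  show "(\<lambda>k. (\<integral>x. poisson_weight k (\<mu> * x) \<partial>A) * c k) sums (\<integral>x. g (\<mu> * x) \<partial>A)"
    using *(2) by simp
qed

lemma critical_law_poisson_mixture:
  assumes int: "integrable A (\<lambda>x. x)" and mean: "\<mu> * (\<integral>x. x \<partial>A) = 1"
  shows "critical_law (\<lambda>k. \<integral>x. poisson_weight k (\<mu> * x) \<partial>A)"
proof
  show "(\<lambda>k. \<integral>x. poisson_weight k (\<mu> * x) \<partial>A) sums 1"
    using poisson_mixture_sums(2)[of "\<lambda>_. 1" "\<lambda>_. 1"] poisson_weight_sums A.prob_space by simp
  show "(\<lambda>k. (\<integral>x. poisson_weight k (\<mu> * x) \<partial>A) * real k) sums 1"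
    using poisson_mixture_sums(2)[of real "\<lambda>y. y"] poisson_weight_mean int mean by simp
  fix k
  have "integrable A (\<lambda>x. poisson_weight k (\<mu> * x))"
    using poisson_mixture_sums(1)[of "\<lambda>_. 1" "\<lambda>_. 1"] poisson_weight_sums by simp
  moreover have nonneg: "AE x in A. 0 \<le> poisson_weight k (\<mu> * x)"
    using A_nonneg by eventually_elim (use \<mu> in \<open>simp add: poisson_weight_def\<close>)
  ultimately have "(\<integral>x. poisson_weight k (\<mu> * x) \<partial>A) = 0 \<longleftrightarrow> (AE x in A. poisson_weight k (\<mu> * x) = 0)"
    by (rule integral_nonneg_eq_0_iff_AE)
  \<comment> \<open>Vanishing weights would force \<open>x = 0\<close> almost everywhere (vacuously
    for \<open>k = 0\<close>), against the mean condition.\<close>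
  moreover have "\<not> (AE x in A. poisson_weight k (\<mu> * x) = 0)"
  proof
    assume "AE x in A. poisson_weight k (\<mu> * x) = 0"
    then have "AE x in A. x = 0"
      by eventually_elim (use \<mu> in \<open>simp add: poisson_weight_def\<close>)
    then have "(\<integral>x. x \<partial>A) = 0"
      by (rule integral_eq_zero_AE)
    then show False
      using mean by simp
  qed
  ultimately show "0 < (\<integral>x. poisson_weight k (\<mu> * x) \<partial>A)"
    using integral_nonneg_AE[OF nonneg] by linarith
qed

end

theorem theorem3p3:
  fixes A :: "real measure" and lam \<mu> \<rho> :: real
  assumes "real_distribution A"
    and "AE x in A. 0 \<le> x"
    and "0 < lam" and "0 < \<mu>"
    and "integrable A (\<lambda>x. x)" and "(\<integral>x. x \<partial>A) = 1 / lam"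
    and "\<rho> = lam / \<mu>" and "\<rho> = 1"
    and "integrable A (\<lambda>x. x ^ 2)"
  shows "(\<lambda>n. 1 / loss_prob A \<mu> (n + 1) - 1 / loss_prob A \<mu> n - 2 / rho_moment A \<mu> 2)
           \<in> o(\<lambda>n. 1)"
proof -
  note A = assms(1,2,4)
  define r where "r k = (\<integral>x. poisson_weight k (\<mu> * x) \<partial>A)" for k
  have "\<mu> * (\<integral>x. x \<partial>A) = 1"
    using assms by simp
  then interpret critical_law r
    unfolding r_def by (intro critical_law_poisson_mixture[OF A] assms)
  have "loss_prob A \<mu> n = 1 / (\<Sum>k\<le>n. level r k)" for n
    by (rule loss_prob_eq) (simp_all add: r_def trans_prob_eq[OF A] trans_prob_sum[OF A])
  \<comment> \<open>The reciprocal loss probabilities are partial sums of one fixed sequence, so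
    their increment is a single term.\<close>
  then have diff: "1 / loss_prob A \<mu> (n + 1) - 1 / loss_prob A \<mu> n = level r (Suc n)" for n
    by simp
  \<comment> \<open>The second factorial moment of a Poisson law is its squared mean, so that of the
    mixture is \<open>rho_moment A \<mu> 2\<close>.\<close>
  have "(\<lambda>k. r k * (real k * (real k - 1))) sums (\<integral>x. (\<mu> * x)\<^sup>2 \<partial>A)"
    unfolding r_def
  proof (rule poisson_mixture_sums(2)[OF A _ poisson_weight_factorial_moment])
    show "0 \<le> real k * (real k - 1)" for k
      by (cases k) auto
    show "integrable A (\<lambda>x. (\<mu> * x)\<^sup>2)"
      using assms(9) by (simp add: power_mult_distrib)
  qed
  also have "(\<integral>x. (\<mu> * x)\<^sup>2 \<partial>A) = rho_moment A \<mu> 2"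
    by (simp add: rho_moment_def power_mult_distrib)
  finally have "(\<lambda>n. level r (Suc n)) \<longlonglongrightarrow> 2 / rho_moment A \<mu> 2"
    by (intro LIMSEQ_Suc level_tendsto)
  then have "(\<lambda>n. level r (Suc n) - 2 / rho_moment A \<mu> 2) \<longlonglongrightarrow> 0"
    by (rule Lim_null[THEN iffD1])
  then show ?thesis
    unfolding diff by (intro smalloI_tendsto) simp_all
qed

end
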